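(* (i) If $n=2^k-2$ for an integer $k\ge 3$, then \[\mathbf m(n,2n+1)\ge \frac{C_{n+1}+3}{2}.\] (ii) If $n=2^r(2^{2k}+1)-2$ for integers $r,k\ge 1$ (in particular, if $n=2^{2k+1}$ for an integer $k\ge 1$), then \[\mathbf m(n,2n+1)\ge \frac{C_{n+1}}{2}+3.\]
   Context: An $n$-uniform hypergraph $H=(V,E)$ consists of a finite vertex set $V$ and an edge set $E\subseteq\{A\subseteq V: |A|=n\}$. $H$ has property B if it is 2-colorable, i.e., if its vertices can be colored with two colors (red and blue) in such a way that no edge is monochromatic. $\mathbf m(n,v)$ denotes the smallest number of edges $|E|$ of an $n$-uniform hypergraph with $|V|=v$ vertices that does not have property B. $C_n=\frac{1}{n+1}\binom{2n}{n}$ denotes the $n$-th Catalan number, so that $\frac{C_{n+1}}{2}=\frac{(2n+1)!}{n!\,(n+2)!}$. *)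

theory Defs
  imports Complex_Main
begin

definition uniform_hypergraph :: "nat \<Rightarrow> 'a set \<Rightarrow> 'a set set \<Rightarrow> bool" where
  "uniform_hypergraph n V E \<longleftrightarrow> finite V \<and> E \<subseteq> {A. A \<subseteq> V \<and> card A = n}"

datatype color = Red | Blue

definition monochromatic :: "('a \<Rightarrow> color) \<Rightarrow> 'a set \<Rightarrow> bool" where
  "monochromatic f A \<longleftrightarrow> (\<exists>c. \<forall>x\<in>A. f x = c)"

(* Colors given to points outside the vertex set are irrelevant, so total functions suffice. *)
definition property_B :: "'a set set \<Rightarrow> bool" where
  "property_B E \<longleftrightarrow> (\<exists>f :: 'a \<Rightarrow> color. \<forall>A\<in>E. \<not> monochromatic f A)"

(* Every finite hypergraph is isomorphic to one whose vertices are natural numbers, so it is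
   enough to let V range over finite sets of naturals.  The least element exists whenever
   v >= 2 * n - 1 (see min_edges_exists); otherwise the value of LEAST is unspecified. *)
definition min_edges :: "nat \<Rightarrow> nat \<Rightarrow> nat" where
  "min_edges n v = (LEAST e. \<exists>(V :: nat set) E.
     uniform_hypergraph n V E \<and> card V = v \<and> \<not> property_B E \<and> card E = e)"

definition catalan :: "nat \<Rightarrow> real" where
  "catalan n = 1 / (real n + 1) * real ((2 * n) choose n)"

lemma min_edges_exists:
  assumes "2 * n \<le> v + 1"
  shows "\<exists>e (V :: nat set) E.
     uniform_hypergraph n V E \<and> card V = v \<and> \<not> property_B E \<and> card E = e"
proof -
  let ?V = "{..<v}"
  let ?E = "{A. A \<subseteq> ?V \<and> card A = n}"
  have "\<exists>A\<in>?E. monochromatic f A" for f :: "nat \<Rightarrow> color"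
  proof -
    have "?V = {x\<in>?V. f x = Red} \<union> {x\<in>?V. f x = Blue}"
      by (auto intro: color.exhaust)
    then have "card ?V = card ({x\<in>?V. f x = Red} \<union> {x\<in>?V. f x = Blue})"
      by (rule arg_cong)
    also have "\<dots> \<le> card {x\<in>?V. f x = Red} + card {x\<in>?V. f x = Blue}"
      by (rule card_Un_le)
    finally have "v \<le> card {x\<in>?V. f x = Red} + card {x\<in>?V. f x = Blue}"
      by simp
    with assms have "n \<le> card {x\<in>?V. f x = Red} \<or> n \<le> card {x\<in>?V. f x = Blue}"
      by linarith
    then obtain c where "n \<le> card {x\<in>?V. f x = c}" by blast
    then obtain A where "A \<subseteq> {x\<in>?V. f x = c}" "card A = n"
      by (rule obtain_subset_with_card_n)
    then have "A \<in> ?E" and "\<forall>x\<in>A. f x = c" by auto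
    then show ?thesis unfolding monochromatic_def by (intro bexI[of _ A] exI[of _ c])
  qed
  then have "\<not> property_B ?E" by (simp add: property_B_def)
  moreover have "uniform_hypergraph n ?V ?E" unfolding uniform_hypergraph_def by simp
  moreover have "card ?V = v" by simp
  ultimately show ?thesis by (intro exI conjI) (assumption | rule refl)+
qed

end

theory Submission
  imports Defs
begin

text \<open>
  For an \<open>n\<close>-set \<open>S\<close> of vertices, colouring \<open>S\<close> against its complement shows that
  some edge equals \<open>S\<close> or is disjoint from it; say that such an edge covers \<open>S\<close>. Every edge
  covers exactly \<open>n + 2\<close> sets, which gives the trivial bound \<open>C\<^sub>n\<^sub>+\<^sub>1 / 2\<close>.
  For even \<open>n\<close> the covering cannot be exact near an edge \<open>A\<close>: given \<open>x \<in> A\<close>, if \<open>A\<close>,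
  the \<open>n\<close>-sets disjoint from \<open>A\<close> and the sets \<open>A - {x} \<union> {y}\<close> were all covered once, the edges
  covering the latter sets would match the \<open>n + 1\<close> points outside \<open>A\<close> in pairs.
  Double counting then yields at least \<open>|E| / (2n + 3)\<close> multiply covered sets, whereas
  fewer than \<open>C\<^sub>n\<^sub>+\<^sub>1 / 2 + 3\<close> edges leave room for fewer than \<open>3(n + 2)\<close> of them.
\<close>

section \<open>Covering \<open>n\<close>-sets by edges and counting multiplicities\<close>

definition nsets :: "nat \<Rightarrow> 'a set \<Rightarrow> 'a set set" where
  "nsets n V = {S. S \<subseteq> V \<and> card S = n}"

definition covers :: "'a set set \<Rightarrow> 'a set \<Rightarrow> 'a set set" where
  "covers E S = {A \<in> E. A = S \<or> A \<inter> S = {}}"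

definition overcovered :: "nat \<Rightarrow> 'a set \<Rightarrow> 'a set set \<Rightarrow> 'a set set" where
  "overcovered n V E = {S \<in> nsets n V. 2 \<le> card (covers E S)}"

lemma finite_nsets: "finite V \<Longrightarrow> finite (nsets n V)"
  unfolding nsets_def by (rule finite_subset[of _ "Pow V"]) auto

lemma card_nsets: "finite V \<Longrightarrow> card (nsets n V) = card V choose n"
  unfolding nsets_def by (rule n_subsets)

lemma nsets_finite: "finite V \<Longrightarrow> S \<in> nsets n V \<Longrightarrow> finite S"
  unfolding nsets_def by (auto intro: finite_subset)

lemma covers_nonempty:
  assumes "finite V" "E \<subseteq> nsets n V" "\<not> property_B E" "S \<in> nsets n V"
  shows "covers E S \<noteq> {}"
proof -
  define f where "f x = (if x \<in> S then Red else Blue)" for x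
  obtain A where A: "A \<in> E" "monochromatic f A"
    using assms(3) unfolding property_B_def by blast
  then obtain c where c: "\<forall>x\<in>A. f x = c" unfolding monochromatic_def by blast
  have "A = S \<or> A \<inter> S = {}"
  proof (cases c)
    case Red
    then have "A \<subseteq> S" using c by (auto simp: f_def split: if_splits)
    moreover have "card A = card S" using A(1) assms(2,4) by (auto simp: nsets_def)
    ultimately show ?thesis using nsets_finite[OF assms(1,4)] by (simp add: card_subset_eq)
  next
    case Blue
    then show ?thesis using c by (auto simp: f_def split: if_splits)
  qed
  then show ?thesis using A(1) by (auto simp: covers_def)
qed

lemma card_covered_by:
  assumes "finite V" "card V = 2 * n + 1" "n \<ge> 1" "A \<in> nsets n V"
  shows "card {S \<in> nsets n V. A = S \<or> A \<inter> S = {}} = n + 2"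
proof -
  have eq: "{S \<in> nsets n V. A = S \<or> A \<inter> S = {}} = insert A (nsets n (V - A))"
    using assms(4) by (auto simp: nsets_def)
  have A: "A \<subseteq> V" "card A = n" using assms(4) by (auto simp: nsets_def)
  have "card (V - A) = n + 1"
    using A assms(1,2) by (simp add: card_Diff_subset finite_subset)
  then have "card (nsets n (V - A)) = n + 1"
    using assms(1) by (simp add: card_nsets)
  \<comment> \<open>An empty \<open>A\<close> would be its own disjoint \<open>n\<close>-set; for
    \<open>n \<ge> 1\<close> the edge adds one to the \<open>n + 1\<close> sets inside its
    complement.\<close>
  moreover have "A \<noteq> {}" using assms(3) A by auto
  then have "A \<notin> nsets n (V - A)" by (auto simp: nsets_def)
  ultimately show ?thesis
    unfolding eq using assms(1) by (simp add: finite_nsets)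
qed

lemma sum_card_covers:
  assumes "finite V" "card V = 2 * n + 1" "n \<ge> 1" "E \<subseteq> nsets n V"
  shows "(\<Sum>S\<in>nsets n V. card (covers E S)) = (n + 2) * card E"
proof -
  have fE: "finite E" using assms(1,4) finite_nsets finite_subset by blast
  have "(\<Sum>S\<in>nsets n V. card (covers E S))
      = (\<Sum>A\<in>E. card {S \<in> nsets n V. A = S \<or> A \<inter> S = {}})"
    unfolding covers_def by (rule sum_multicount_gen) (auto simp: fE assms(1) finite_nsets)
  also have "\<dots> = (\<Sum>A\<in>E. n + 2)"
    using assms by (intro sum.cong refl card_covered_by) auto
  finally show ?thesis by simp
qed

text \<open>In the sum of covering multiplicities every \<open>n\<close>-set contributes at least 1,
  and an overcovered one at least 2.\<close>

lemma card_overcovered_le: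
  assumes "finite V" "card V = 2 * n + 1" "n \<ge> 1" "E \<subseteq> nsets n V" "\<not> property_B E"
  shows "(2 * n + 1 choose n) + card (overcovered n V E) \<le> (n + 2) * card E"
proof -
  have fE: "finite E" using assms(1,4) finite_nsets finite_subset by blast
  have fin: "finite (nsets n V)" by (simp add: assms(1) finite_nsets)
  have "(2 * n + 1 choose n) + card (overcovered n V E)
      = (\<Sum>S\<in>nsets n V. 1 + (if 2 \<le> card (covers E S) then 1 else 0))"
    using fin assms(1,2) unfolding overcovered_def
    by (simp only: sum.distrib sum.inter_filter[symmetric]) (simp add: card_nsets)
  also have "\<dots> \<le> (\<Sum>S\<in>nsets n V. card (covers E S))"
  proof (rule sum_mono)
    fix S assume "S \<in> nsets n V"
    then have "covers E S \<noteq> {}" using assms covers_nonempty by blast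
    moreover have "finite (covers E S)" using fE by (simp add: covers_def)
    ultimately have "card (covers E S) \<noteq> 0" by simp
    then show "1 + (if 2 \<le> card (covers E S) then 1 else 0) \<le> card (covers E S)" by auto
  qed
  finally show ?thesis using assms by (simp add: sum_card_covers)
qed

lemma overcoveredI:
  assumes "finite V" "E \<subseteq> nsets n V" "S \<in> nsets n V"
    and "A \<in> covers E S" "B \<in> covers E S" "A \<noteq> B"
  shows "S \<in> overcovered n V E"
proof -
  have "finite (covers E S)"
    using assms(1,2) finite_nsets finite_subset unfolding covers_def by fastforce
  then have "card {A, B} \<le> card (covers E S)" using assms(4,5) by (intro card_mono) auto
  then show ?thesis using assms(3,6) by (simp add: overcovered_def)
qed

section \<open>A multiply covered set near every edge\<close>

text \<open>The pairs of matched points partition \<open>U\<close> into 2-sets: two pairs sharing a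
  point \<open>w\<close> both join it to its only partner.\<close>

lemma even_card_if_matched:
  assumes "finite U"
    and sym: "\<And>y z. R y z \<Longrightarrow> R z y"
    and irr: "\<And>y. \<not> R y y"
    and ex1: "\<And>y. y \<in> U \<Longrightarrow> \<exists>!z. z \<in> U \<and> R y z"
  shows "even (card U)"
proof -
  define C where "C = {{y, z} | y z. y \<in> U \<and> z \<in> U \<and> R y z}"
  have "\<Union>C \<subseteq> U" unfolding C_def by auto
  moreover have "U \<subseteq> \<Union>C"
  proof
    fix y assume y: "y \<in> U"
    then obtain z where "z \<in> U" "R y z" using ex1 by blast
    with y have "{y, z} \<in> C" unfolding C_def by blast
    then show "y \<in> \<Union>C" by blast
  qed
  ultimately have U: "\<Union>C = U" by blast
  have "2 * card C = card (\<Union>C)"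
  proof (rule card_partition)
    show "finite (\<Union>C)" using U assms(1) by simp
    then show "finite C" by (rule finite_UnionD)
    show "card c = 2" if c: "c \<in> C" for c
    proof -
      obtain y z where "c = {y, z}" "R y z" using c unfolding C_def by blast
      moreover from this have "y \<noteq> z" using irr by blast
      ultimately show ?thesis by simp
    qed
    show "c \<inter> d = {}" if cd: "c \<in> C" "d \<in> C" "c \<noteq> d" for c d
    proof (rule ccontr)
      assume "c \<inter> d \<noteq> {}"
      then obtain w where w: "w \<in> c" "w \<in> d" by blast
      have partner: "\<exists>z. z \<in> U \<and> R w z \<and> b = {w, z}" if b: "b \<in> C" "w \<in> b" for b
      proof -
        obtain y z where "b = {y, z}" "y \<in> U" "z \<in> U" "R y z" "R z y"
          using b(1) sym unfolding C_def by blast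
        then show ?thesis using b(2) by (cases "w = y") (auto simp: insert_commute)
      qed
      obtain z where z: "z \<in> U" "R w z" "c = {w, z}" using partner[OF cd(1) w(1)] by blast
      obtain z' where z': "z' \<in> U" "R w z'" "d = {w, z'}" using partner[OF cd(2) w(2)] by blast
      have "w \<in> U" using w cd(1) U by blast
      then have "z = z'" using ex1 z z' by blast
      then show False using cd(3) z z' by simp
    qed
  qed
  then have "card U = 2 * card C" using U by simp
  then show ?thesis by simp
qed

text \<open>Otherwise, for each \<open>y\<close> outside \<open>A\<close>, the edge covering
  \<open>A\<close> with \<open>x\<close> exchanged for \<open>y\<close> is unique and consists of
  \<open>x\<close> and all points outside \<open>A\<close> except \<open>y\<close> and one further
  point \<open>z\<close>. This is symmetric in \<open>y\<close> and \<open>z\<close>, so the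
  \<open>n + 1\<close> outside points are matched in pairs, which is impossible for even
  \<open>n\<close>.\<close>

lemma overcovered_near_edge:
  assumes fV: "finite V" and cV: "card V = 2 * n + 1" and n: "even n"
    and E: "E \<subseteq> nsets n V" and nB: "\<not> property_B E" and A: "A \<in> E" and x: "x \<in> A"
  obtains S where "S \<in> overcovered n V E"
    and "S = A \<or> S \<inter> A = {} \<or> (\<exists>y \<in> V - A. S = insert y (A - {x}))"
proof (rule ccontr)
  note goal = that
  assume "\<not> thesis"
  then have no: "S \<notin> overcovered n V E"
    if "S = A \<or> S \<inter> A = {} \<or> (\<exists>y \<in> V - A. S = insert y (A - {x}))" for S
    using goal that by blast
  define U where "U = V - A"
  have AV: "A \<subseteq> V" "card A = n" "finite A"
    using A E fV by (auto simp: nsets_def intro: finite_subset)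
  have fU: "finite U" using fV by (simp add: U_def)
  have cU: "card U = n + 1" using AV cV by (simp add: U_def card_Diff_subset)
  have xU: "x \<notin> U" using x by (auto simp: U_def)
  \<comment> \<open>\<open>A\<close> covers itself, so a second edge disjoint from \<open>A\<close>
    would make \<open>A\<close> overcovered.\<close>
  have A_single: "B = A" if "B \<in> E" "B \<inter> A = {} \<or> B = A" for B
    using no[of A] that overcoveredI[OF fV E, of A A B] A E by (auto simp: covers_def)
  define R where "R y z \<longleftrightarrow> y \<noteq> z \<and> insert x (U - {y, z}) \<in> E" for y z
  have "\<exists>!z. z \<in> U \<and> R y z" if y: "y \<in> U" for y
  proof -
    define S where "S = insert y (A - {x})"
    have yA: "y \<notin> A" "y \<in> V" using y by (auto simp: U_def)
    have "n \<ge> 1" using x AV by (cases n) auto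
    then have S: "S \<in> nsets n V" using AV yA x by (auto simp: S_def nsets_def)
    have S_single: "B = B'" if "B \<in> covers E S" "B' \<in> covers E S" for B B'
    proof (rule ccontr)
      assume "B \<noteq> B'"
      then have "S \<in> overcovered n V E" using overcoveredI[OF fV E S] that by blast
      then show False using no[of S] yA S_def by blast
    qed
    \<comment> \<open>Otherwise \<open>A\<close> and \<open>S\<close> would both cover
      \<open>U - {y}\<close>, which is disjoint from each of them.\<close>
    have "S \<notin> E"
    proof
      assume "S \<in> E"
      have "U - {y} \<in> nsets n V" using cU fU y by (auto simp: nsets_def U_def)
      moreover have "A \<in> covers E (U - {y})" "S \<in> covers E (U - {y})"
        using A \<open>S \<in> E\<close> by (auto simp: covers_def U_def S_def)
      moreover have "A \<noteq> S" using yA by (auto simp: S_def)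
      ultimately have "U - {y} \<in> overcovered n V E" using overcoveredI[OF fV E] by blast
      moreover have "(U - {y}) \<inter> A = {}" by (auto simp: U_def)
      ultimately show False using no[of "U - {y}"] by blast
    qed
    obtain B where B: "B \<in> covers E S" using covers_nonempty[OF fV E nB S] by blast
    have BE: "B \<in> E" and BS: "B \<inter> S = {}" using B \<open>S \<notin> E\<close> by (auto simp: covers_def)
    have Bn: "B \<subseteq> V" "card B = n" using BE E by (auto simp: nsets_def)
    have "x \<in> B"
    proof (rule ccontr)
      assume "x \<notin> B"
      then have "B \<inter> A = {}" using BS by (auto simp: S_def)
      then show False using A_single[OF BE] x \<open>x \<notin> B\<close> by blast
    qed
    have sub: "B - {x} \<subseteq> U - {y}" using BS Bn by (auto simp: S_def U_def)
    have "finite B" using Bn fV finite_subset by blast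
    \<comment> \<open>\<open>B - {x}\<close> has \<open>n - 1\<close> points in the
      \<open>n\<close>-set \<open>U - {y}\<close>; the missing one is the partner of
      \<open>y\<close>.\<close>
    then have "card (U - {y} - (B - {x})) = 1"
      using sub cU fU y \<open>x \<in> B\<close> Bn \<open>n \<ge> 1\<close> by (simp add: card_Diff_subset)
    then obtain z where z: "U - {y} - (B - {x}) = {z}" by (auto simp: card_1_singleton_iff)
    have "B = insert x (U - {y, z})" using z sub \<open>x \<in> B\<close> xU by blast
    then have Rz: "z \<in> U \<and> R y z" using z BE by (auto simp: R_def)
    have "z' = z" if "z' \<in> U \<and> R y z'" for z'
    proof -
      have "insert x (U - {y, w}) \<in> covers E S" if "R y w" for w
        using that yA x by (auto simp: R_def covers_def S_def U_def)
      then have "insert x (U - {y, z'}) = insert x (U - {y, z})"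
        using that Rz by (intro S_single) auto
      then show ?thesis using that Rz xU by (auto simp: R_def)
    qed
    then show ?thesis using Rz by blast
  qed
  then have "even (card U)"
    by (intro even_card_if_matched[OF fU, of R]) (auto simp: R_def insert_commute)
  then show False using cU n by simp
qed

section \<open>Double counting of edges against overcovered sets\<close>

text \<open>There are \<open>n * card E\<close> pairs of an edge \<open>A\<close> and a point
  \<open>x \<in> A\<close>. Each is sent to an overcovered set near it, and such a set receives at
  most \<open>n + 2 * n * (n + 1) = n * (2 * n + 3)\<close> pairs.\<close>

lemma card_edges_le_overcovered:
  assumes fV: "finite V" and cV: "card V = 2 * n + 1" and n: "even n" "n \<ge> 1"
    and E: "E \<subseteq> nsets n V" and nB: "\<not> property_B E"
  shows "card E \<le> (2 * n + 3) * card (overcovered n V E)"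
proof -
  \<comment> \<open>All candidate pairs \<open>(A, x)\<close> to which \<open>S\<close> can be near,
    one piece per alternative: \<open>A\<close> equals \<open>S\<close>, \<open>A\<close> is
    disjoint from \<open>S\<close> and so misses one point \<open>y\<close> of \<open>V - S\<close>,
    or \<open>A\<close> arises from \<open>S\<close> by exchanging \<open>s\<close> for
    \<open>x\<close>.\<close>
  define F where "F S = {S} \<times> S
      \<union> (\<lambda>(y, x). (V - S - {y}, x)) ` (SIGMA y : V - S. V - S - {y})
      \<union> (\<lambda>(s, x). (insert x (S - {s}), x)) ` (S \<times> (V - S))" for S
  have fO: "finite (overcovered n V E)" using fV by (simp add: overcovered_def finite_nsets)
  have fE: "finite E" using fV E finite_nsets finite_subset by blast
  have flag: "(SIGMA A : E. A) \<subseteq> (\<Union>S\<in>overcovered n V E. F S)"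
  proof clarify
    fix A x assume A: "A \<in> E" and x: "x \<in> A"
    obtain S where S: "S \<in> overcovered n V E"
      and near: "S = A \<or> S \<inter> A = {} \<or> (\<exists>y \<in> V - A. S = insert y (A - {x}))"
      using overcovered_near_edge[OF fV cV n(1) E nB A x] .
    have AV: "A \<subseteq> V" "card A = n" "finite A"
      using A E fV by (auto simp: nsets_def intro: finite_subset)
    have SV: "S \<subseteq> V" "card S = n" "finite S"
      using S fV by (auto simp: overcovered_def nsets_def intro: finite_subset)
    consider "S = A" | "S \<inter> A = {}" | y where "y \<in> V - A" "S = insert y (A - {x})"
      using near by blast
    then have "(A, x) \<in> F S"
    proof cases
      case 1
      then show ?thesis using x by (simp add: F_def)
    next
      case 2
      have "card (V - S - A) = 1"
        using 2 AV SV fV cV by (subst card_Diff_subset) (auto simp: card_Diff_subset)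
      then obtain y where y: "V - S - A = {y}" by (auto simp: card_1_singleton_iff)
      have "A = V - S - {y}" using y 2 AV by blast
      moreover have "y \<in> V - S" using y by blast
      ultimately have "(A, x) \<in> (\<lambda>(y, x). (V - S - {y}, x)) ` (SIGMA y : V - S. V - S - {y})"
        using x by (intro image_eqI[of _ _ "(y, x)"]) auto
      then show ?thesis unfolding F_def by blast
    next
      case (3 y)
      then have "A = insert x (S - {y})" "y \<in> S" "x \<in> V - S" using x AV by auto
      then have "(A, x) \<in> (\<lambda>(s, x). (insert x (S - {s}), x)) ` (S \<times> (V - S))"
        by (intro image_eqI[of _ _ "(y, x)"]) auto
      then show ?thesis unfolding F_def by blast
    qed
    then show "(A, x) \<in> (\<Union>S\<in>overcovered n V E. F S)" using S by blast
  qed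
  have F: "finite (F S) \<and> card (F S) \<le> n * (2 * n + 3)" if "S \<in> overcovered n V E" for S
  proof -
    have S: "S \<subseteq> V" "card S = n" "finite S"
      using that fV by (auto simp: overcovered_def nsets_def intro: finite_subset)
    have c: "card (V - S) = n + 1" using S cV by (simp add: card_Diff_subset)
    have f: "finite (V - S)" using fV by simp
    have "card (F S)
        \<le> card ({S} \<times> S) + card (SIGMA y : V - S. V - S - {y}) + card (S \<times> (V - S))"
      unfolding F_def
      by (intro order_trans[OF card_Un_le] add_mono card_image_le finite_SigmaI finite_cartesian_product)
         (use f S in auto)
    also have "\<dots> = n + (n + 1) * n + n * (n + 1)"
      using f c S by (simp add: card_SigmaI card_cartesian_product)
    also have "\<dots> = n * (2 * n + 3)" by (simp add: algebra_simps)
    finally have "card (F S) \<le> n * (2 * n + 3)" .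
    moreover have "finite (F S)" using f S by (auto simp: F_def)
    ultimately show ?thesis by simp
  qed
  have "n * card E = (\<Sum>A\<in>E. card A)" using E by (simp add: nsets_def subset_iff)
  also have "\<dots> = card (SIGMA A : E. A)"
    using fE E fV nsets_finite by (subst card_SigmaI) auto
  also have "\<dots> \<le> card (\<Union>S\<in>overcovered n V E. F S)"
    using flag fO F by (intro card_mono) auto
  also have "\<dots> \<le> (\<Sum>S\<in>overcovered n V E. card (F S))" using fO by (rule card_UN_le)
  also have "\<dots> \<le> card (overcovered n V E) * (n * (2 * n + 3))"
    using F by (intro order_trans[OF sum_bounded_above]) auto
  finally have "n * card E \<le> n * ((2 * n + 3) * card (overcovered n V E))"
    by (simp add: algebra_simps)
  then show ?thesis using n(2) by simp
qed

section \<open>Growth of the middle binomial coefficient\<close>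

lemma central_binomial_step:
  "(n + 2) * (2 * Suc n + 1 choose Suc n) = 2 * (2 * n + 3) * (2 * n + 1 choose n)"
proof -
  have up: "Suc n * (2 * n + 3 choose Suc n) = (2 * n + 3) * (2 * n + 2 choose n)"
    using Suc_times_binomial[of n "2 * n + 2"] by (simp only: numeral_3_eq_3 numeral_2_eq_2 add_Suc_right)
  have "(n + 2) * (2 * n + 2 choose n) = (2 * n + 2) * (2 * n + 1 choose n)"
    using binomial_absorb_comp[of "2 * n + 2" n] by (simp del: binomial_Suc_Suc)
  moreover have "Suc n * ((n + 2) * p) = Suc n * (2 * (2 * n + 3) * r)"
    if "Suc n * p = (2 * n + 3) * q" "(n + 2) * q = (2 * n + 2) * r" for p q r
  proof -
    have "Suc n * ((n + 2) * p) = (n + 2) * (Suc n * p)" by (simp only: mult.left_commute)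
    also have "\<dots> = (2 * n + 3) * ((n + 2) * q)" unfolding that(1) by (simp only: mult.left_commute)
    also have "\<dots> = Suc n * (2 * (2 * n + 3) * r)" unfolding that(2) by (simp add: algebra_simps)
    finally show ?thesis .
  qed
  ultimately have "Suc n * ((n + 2) * (2 * n + 3 choose Suc n))
      = Suc n * (2 * (2 * n + 3) * (2 * n + 1 choose n))"
    using up by blast
  then have "(n + 2) * (2 * n + 3 choose Suc n) = 2 * (2 * n + 3) * (2 * n + 1 choose n)"
    by (simp only: mult_cancel1) simp
  moreover have "2 * Suc n + 1 = 2 * n + 3" by simp
  ultimately show ?thesis by (simp only:)
qed

text \<open>From \<open>n\<close> to \<open>n + 1\<close> the binomial coefficient at least triples,
  since \<open>2 * (2 * n + 3) \<ge> 3 * (n + 2)\<close>, while the cubic grows at most threefold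
  for \<open>n \<ge> 1\<close>. One check at \<open>n0\<close> therefore suffices.\<close>

lemma central_binomial_ge:
  assumes "n \<ge> n0" and "c * ((n0 + 2)\<^sup>2 * (2 * n0 + 3)) \<le> d * (2 * n0 + 1 choose n0)" and "n0 \<ge> 1"
  shows "c * ((n + 2)\<^sup>2 * (2 * n + 3)) \<le> d * (2 * n + 1 choose n)"
  using assms(1)
proof (induction n rule: dec_induct)
  case base
  show ?case by (rule assms(2))
next
  case (step m)
  have "(m + 2) * (3 * (2 * m + 1 choose m)) \<le> (m + 2) * (2 * Suc m + 1 choose Suc m)"
    unfolding central_binomial_step by (simp add: algebra_simps)
  then have N: "3 * (2 * m + 1 choose m) \<le> (2 * Suc m + 1 choose Suc m)"
    by (simp only: mult_le_cancel1)
  \<comment> \<open>The threefold bound on the cubic fails at \<open>m = 0\<close>; after the shift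
    it holds coefficient by coefficient.\<close>
  obtain k where k: "m = k + 1" using step assms(3) by (cases m) auto
  have "(Suc m + 2)\<^sup>2 * (2 * Suc m + 3) \<le> 3 * ((m + 2)\<^sup>2 * (2 * m + 3))"
    unfolding k by (simp add: power2_eq_square algebra_simps)
  then have "c * ((Suc m + 2)\<^sup>2 * (2 * Suc m + 3)) \<le> c * (3 * ((m + 2)\<^sup>2 * (2 * m + 3)))"
    by (rule mult_le_mono2)
  also have "\<dots> = 3 * (c * ((m + 2)\<^sup>2 * (2 * m + 3)))" by (rule mult.left_commute)
  also have "\<dots> \<le> d * (3 * (2 * m + 1 choose m))" using step.IH by simp
  also have "\<dots> \<le> d * (2 * Suc m + 1 choose Suc m)" using N by (rule mult_left_mono) simp
  finally show ?case .
qed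

section \<open>Lower bounds on the number of edges\<close>

text \<open>The right-hand side is the number of edges that an exact covering of all
  \<open>n\<close>-sets would take.\<close>

lemma catalan_Suc_half: "catalan (n + 1) / 2 = real (2 * n + 1 choose n) / real (n + 2)"
proof -
  have "(2 * (n + 1)) choose (n + 1) = (2 * n + 1 choose n) + (2 * n + 1 choose (n + 1))"
    by simp
  also have "(2 * n + 1 choose (n + 1)) = (2 * n + 1 choose n)"
    using binomial_symmetric[of n "2 * n + 1"] by simp
  finally have c: "(2 * (n + 1)) choose (n + 1) = 2 * (2 * n + 1 choose n)" by simp
  show ?thesis unfolding catalan_def c by (simp add: field_simps)
qed

text \<open>Fewer edges would leave \<open>d * b < c * (n + 2)\<close> for the number
  \<open>b\<close> of overcovered sets. As \<open>card E \<le> (2 * n + 3) * b\<close>, the edges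
  could then not cover all \<open>n\<close>-sets once \<open>N\<close> holds.\<close>

lemma card_edges_ge:
  assumes "finite V" "card V = 2 * n + 1" "even n" "n \<ge> 1" "E \<subseteq> nsets n V" "\<not> property_B E"
    and N: "c * ((n + 2)\<^sup>2 * (2 * n + 3)) \<le> d * (2 * n + 1 choose n)" and "d > 0"
  shows "real (card E) \<ge> catalan (n + 1) / 2 + real c / real d"
proof (rule ccontr)
  define b where "b = card (overcovered n V E)"
  have le: "(2 * n + 1 choose n) + b \<le> (n + 2) * card E"
    using assms card_overcovered_le unfolding b_def by blast
  have eb: "card E \<le> (2 * n + 3) * b"
    using assms card_edges_le_overcovered unfolding b_def by blast
  assume "\<not> ?thesis"
  then have lt: "real (card E) < real (2 * n + 1 choose n) / real (n + 2) + real c / real d"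
    unfolding catalan_Suc_half by simp
  have clear: "D * (M * e) < D * N + C * M" if "e < N / M + C / D" "M > 0" "D > 0"
    for D M e N C :: real
    using that by (simp add: field_simps)
  have "real d * (real (n + 2) * real (card E))
      < real d * real (2 * n + 1 choose n) + real c * real (n + 2)"
    by (rule clear[OF lt]) (use \<open>d > 0\<close> in auto)
  then have "d * ((n + 2) * card E) < d * (2 * n + 1 choose n) + c * (n + 2)"
    by (simp only: of_nat_mult[symmetric] of_nat_add[symmetric] of_nat_less_iff)
  moreover have "d * ((2 * n + 1 choose n) + b) \<le> d * ((n + 2) * card E)"
    using le by (rule mult_left_mono) simp
  ultimately have db: "d * b < c * (n + 2)" unfolding distrib_left by linarith
  have "d * (2 * n + 1 choose n) \<le> d * ((n + 2) * card E)"
    using le by (intro mult_left_mono) auto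
  also have "\<dots> \<le> d * ((n + 2) * ((2 * n + 3) * b))"
    using eb by (intro mult_left_mono) auto
  also have "\<dots> = (n + 2) * (2 * n + 3) * (d * b)" by (simp add: algebra_simps)
  also have "\<dots> < (n + 2) * (2 * n + 3) * (c * (n + 2))" using db by (intro mult_strict_left_mono) simp_all
  also have "\<dots> = c * ((n + 2)\<^sup>2 * (2 * n + 3))" by (simp add: power2_eq_square algebra_simps)
  finally show False using leD[OF N] by blast
qed

lemma min_edges_ge:
  assumes "even n" "n \<ge> 1" "c * ((n + 2)\<^sup>2 * (2 * n + 3)) \<le> d * (2 * n + 1 choose n)" "d > 0"
  shows "real (min_edges n (2 * n + 1)) \<ge> catalan (n + 1) / 2 + real c / real d"
proof -
  have "\<exists>(V :: nat set) E. uniform_hypergraph n V E \<and> card V = 2 * n + 1 \<and> \<not> property_B E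
      \<and> card E = min_edges n (2 * n + 1)"
    \<comment> \<open>The minimum is attained because non-2-colorable hypergraphs exist on
      \<open>2 * n + 1 \<ge> 2 * n - 1\<close> vertices.\<close>
    unfolding min_edges_def by (rule LeastI_ex) (rule min_edges_exists, simp)
  then obtain V :: "nat set" and E where "uniform_hypergraph n V E" "card V = 2 * n + 1"
    "\<not> property_B E" "card E = min_edges n (2 * n + 1)" by blast
  then show ?thesis
    using card_edges_ge[of V n E c d] assms by (simp add: uniform_hypergraph_def nsets_def)
qed

text \<open>The smallest even \<open>n\<close> meeting the numerical condition for
  \<open>c / d = 3 / 2\<close> is 6, where it reads \<open>2880 \<le> 3432\<close>.\<close>

lemma min_edges_ge_three_halves:
  assumes "even n" "n \<ge> 6"
  shows "real (min_edges n (2 * n + 1)) \<ge> (catalan (n + 1) + 3) / 2"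
proof -
  have "2 * 6 + 1 choose 6 = (1716 :: nat)" by (simp add: binomial_fact' fact_numeral)
  then have "3 * ((6 + 2)\<^sup>2 * (2 * 6 + 3)) \<le> 2 * (2 * 6 + 1 choose (6 :: nat))"
    by (simp only:) simp
  then have "3 * ((n + 2)\<^sup>2 * (2 * n + 3)) \<le> 2 * (2 * n + 1 choose n)"
    by (rule central_binomial_ge[OF assms(2)]) simp
  then show ?thesis using min_edges_ge[of n 3 2] assms by (simp add: add_divide_distrib)
qed

text \<open>For \<open>c / d = 3\<close> the condition fails at 6 and holds at 8, where it reads
  \<open>5700 \<le> 24310\<close>.\<close>

lemma min_edges_ge_three:
  assumes "even n" "n \<ge> 8"
  shows "real (min_edges n (2 * n + 1)) \<ge> catalan (n + 1) / 2 + 3"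
proof -
  have "2 * 8 + 1 choose 8 = (24310 :: nat)" by (simp add: binomial_fact' fact_numeral)
  then have "3 * ((8 + 2)\<^sup>2 * (2 * 8 + 3)) \<le> 1 * (2 * 8 + 1 choose (8 :: nat))"
    by (simp only:) simp
  then have "3 * ((n + 2)\<^sup>2 * (2 * n + 3)) \<le> 1 * (2 * n + 1 choose n)"
    by (rule central_binomial_ge[OF assms(2)]) simp
  then show ?thesis using min_edges_ge[of n 3 1] assms by simp
qed

theorem theorem2:
  fixes n :: nat
  shows "(\<forall>k::nat. k \<ge> 3 \<longrightarrow> n = 2 ^ k - 2 \<longrightarrow>
            real (min_edges n (2 * n + 1)) \<ge> (catalan (n + 1) + 3) / 2) \<and>
         (\<forall>r k::nat. r \<ge> 1 \<longrightarrow> k \<ge> 1 \<longrightarrow> n = 2 ^ r * (2 ^ (2 * k) + 1) - 2 \<longrightarrow>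
            real (min_edges n (2 * n + 1)) \<ge> catalan (n + 1) / 2 + 3) \<and>
         (\<forall>k::nat. k \<ge> 1 \<longrightarrow> n = 2 ^ (2 * k + 1) \<longrightarrow>
            real (min_edges n (2 * n + 1)) \<ge> catalan (n + 1) / 2 + 3)"
proof (intro conjI allI impI)
  fix k :: nat assume k: "k \<ge> 3" and n: "n = 2 ^ k - 2"
  have "(2::nat) ^ 3 \<le> 2 ^ k" using k by (rule power_increasing) simp
  moreover have "even ((2::nat) ^ k)" using k by simp
  ultimately show "real (min_edges n (2 * n + 1)) \<ge> (catalan (n + 1) + 3) / 2"
    using n by (intro min_edges_ge_three_halves) auto
next
  fix r k :: nat assume r: "r \<ge> 1" and k: "k \<ge> 1" and n: "n = 2 ^ r * (2 ^ (2 * k) + 1) - 2"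
  have "(2::nat) ^ 1 \<le> 2 ^ r" "(2::nat) ^ 2 \<le> 2 ^ (2 * k)"
    using r k by (intro power_increasing; simp)+
  \<comment> \<open>The product is at least 10, hence \<open>n \<ge> 8\<close>.\<close>
  then have "2 * (4 + 1) \<le> (2::nat) ^ r * (2 ^ (2 * k) + 1)"
    by (intro mult_mono) auto
  moreover have "even ((2::nat) ^ r * (2 ^ (2 * k) + 1))" using r by simp
  ultimately show "real (min_edges n (2 * n + 1)) \<ge> catalan (n + 1) / 2 + 3"
    using n by (intro min_edges_ge_three) auto
next
  fix k :: nat assume k: "k \<ge> 1" and n: "n = 2 ^ (2 * k + 1)"
  \<comment> \<open>This is the family above with \<open>r = 1\<close>, since
    \<open>2 * (2 ^ (2 * k) + 1) - 2 = 2 ^ (2 * k + 1)\<close>; the bound \<open>n \<ge> 8\<close>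
    is read off directly.\<close>
  have "(2::nat) ^ 3 \<le> 2 ^ (2 * k + 1)" using k by (intro power_increasing) auto
  then show "real (min_edges n (2 * n + 1)) \<ge> catalan (n + 1) / 2 + 3"
    using n by (intro min_edges_ge_three) auto
qed

end
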